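(* Let $K$ be a finite simplicial complex with a chosen total ordering of its vertices, let $n$ be a positive integer, and let $W=W(K,n)$ be the discrete field on $\operatorname{DConf}(K,n)$ constructed by the algorithm described in the context. Then $W$ is gradient, i.e. no gradient path of $W$ is a cycle.
   Context: Discrete Morse theory. For a finite regular CW complex $X$, the directed Hasse diagram $H$ has the cells of $X$ as vertices and a directed edge $\alpha^{(p+1)}\searrow\beta^{(p)}$ whenever $\beta$ is a codimension-one face of $\alpha$ (superscripts denote dimension). A discrete field is a subgraph $W$ of $H$ all of whose vertices have degree 1 in $W$ (i.e. a matching). Reversing in $H$ the arrows of $W$ gives $H_W$; reversed arrows are written $\beta^{(p)}\nearrow\alpha^{(p+1)}$. A gradient path is a chain $\alpha_0\nearrow\beta_1\searrow\alpha_1\nearrow\cdots\nearrow\beta_k\searrow\alpha_k$ of alternating up-going/down-going edges of $H_W$ with $k>0$; it is a cycle if $\alpha_0=\alpha_k$. The field is gradient if no gradient path is a cycle. The complex. Let $K$ be a finite simplicial complex with vertex set $V=\{1,2,\ldots,m\}$ (the identification encoding the chosen order). $\operatorname{DConf}(K,n)$ is the subcomplex of the product complex $K^n$ whose cells are the products $\alpha=(\alpha_1,\ldots,\alpha_n)$ of simplices of $K$ with pairwise disjoint vertex sets. Let $V(\alpha)$ be the union of these vertex sets. For $v\in V\setminus V(\alpha)$ such that adding $v$ to $\alpha_i$ gives a simplex of $K$, $\alpha+_iv$ denotes the cell obtained by adding $v$ to the $i$-th entry. Order on cells. Simplices of $K$ of the same dimension, written as increasing lists of vertices, are ordered lexicographically;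 simplices of smaller dimension precede those of larger dimension. Cells of $K^n$ are then ordered lexicographically over the $n$ coordinates. Construction of $W(K,n)$. Initialize $W:=\varnothing$ and, for each $p$, let $A^p$ be the set of all $p$-dimensional cells of $X=\operatorname{DConf}(K,n)$ ("available" cells). For $p=\dim X-1,\dim X-2,\ldots,0$ (in that order), provided $A^p$ and $A^{p+1}$ are currently nonempty, do: for $r=n,n-1,\ldots,1$ (in that order); for $u=m,m-1,\ldots,1$ (in that order); for $\alpha$ running through the current $A^p$ in increasing order: if $\alpha+_ru$ is defined and currently $(\alpha,\alpha+_ru)\in A^p\times A^{p+1}$, add the directed edge $\alpha\nearrow\alpha+_ru$ to $W$, and remove $\alpha$ from $A^p$ and $\alpha+_ru$ from $A^{p+1}$. The final $W$ is $W(K,n)$. *)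

theory Defs
  imports Main
begin

section \<open>Discrete fields and gradient paths\<close>

text \<open>
  A Hasse diagram is given by its edge relation \<open>H\<close>, where \<open>(\<alpha>, \<beta>) \<in> H\<close> is the edge
  \<open>\<alpha> \<searrow> \<beta>\<close>.  A subgraph without isolated vertices is determined by its edges, so a discrete
  field is a set \<open>W \<subseteq> H\<close> of edges (with the downward direction they have in \<open>H\<close>) and its
  vertex set is \<open>Field W\<close>.
\<close>

definition degree_in :: "('c \<times> 'c) set \<Rightarrow> 'c \<Rightarrow> nat" where
  "degree_in W v = card {e \<in> W. fst e = v \<or> snd e = v}"

definition discrete_field :: "('c \<times> 'c) set \<Rightarrow> ('c \<times> 'c) set \<Rightarrow> bool" where
  "discrete_field H W \<longleftrightarrow> W \<subseteq> H \<and> (\<forall>v \<in> Field W. degree_in W v = 1)"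

definition modified_hasse :: "('c \<times> 'c) set \<Rightarrow> ('c \<times> 'c) set \<Rightarrow> ('c \<times> 'c) set" where
  "modified_hasse H W = (H - W) \<union> W\<inverse>"

definition up_edge :: "('c \<times> 'c) set \<Rightarrow> ('c \<times> 'c) set \<Rightarrow> 'c \<Rightarrow> 'c \<Rightarrow> bool" where
  "up_edge H W \<beta> \<alpha> \<longleftrightarrow> (\<beta>, \<alpha>) \<in> modified_hasse H W \<and> (\<alpha>, \<beta>) \<in> H"

definition down_edge :: "('c \<times> 'c) set \<Rightarrow> ('c \<times> 'c) set \<Rightarrow> 'c \<Rightarrow> 'c \<Rightarrow> bool" where
  "down_edge H W \<alpha> \<beta> \<longleftrightarrow> (\<alpha>, \<beta>) \<in> modified_hasse H W \<and> (\<alpha>, \<beta>) \<in> H"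

text \<open>
  The path \<open>\<alpha>\<^sub>0 \<nearrow> \<beta>\<^sub>1 \<searrow> \<alpha>\<^sub>1 \<nearrow> \<dots> \<nearrow> \<beta>\<^sub>k \<searrow> \<alpha>\<^sub>k\<close> is given by the lists
  \<open>as = [\<alpha>\<^sub>0, \<dots>, \<alpha>\<^sub>k]\<close> and \<open>bs = [\<beta>\<^sub>1, \<dots>, \<beta>\<^sub>k]\<close>.
\<close>

definition gradient_path ::
  "('c \<times> 'c) set \<Rightarrow> ('c \<times> 'c) set \<Rightarrow> 'c list \<Rightarrow> 'c list \<Rightarrow> bool" where
  "gradient_path H W as bs \<longleftrightarrow>
     length bs > 0 \<and> length as = Suc (length bs) \<and>
     (\<forall>i < length bs. up_edge H W (as ! i) (bs ! i) \<and> down_edge H W (bs ! i) (as ! Suc i))"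

definition gradient_field :: "('c \<times> 'c) set \<Rightarrow> ('c \<times> 'c) set \<Rightarrow> bool" where
  "gradient_field H W \<longleftrightarrow>
     discrete_field H W \<and> \<not> (\<exists>as bs. gradient_path H W as bs \<and> hd as = last as)"


section \<open>The discretized configuration space\<close>

definition simplicial_complex_on :: "nat \<Rightarrow> nat set set \<Rightarrow> bool" where
  "simplicial_complex_on m K \<longleftrightarrow>
     K \<subseteq> Pow {1..m} \<and> {} \<notin> K \<and> (\<forall>v \<in> {1..m}. {v} \<in> K) \<and>
     (\<forall>\<sigma> \<in> K. \<forall>\<tau>. \<tau> \<subseteq> \<sigma> \<and> \<tau> \<noteq> {} \<longrightarrow> \<tau> \<in> K)"

type_synonym cell = "nat set list"

text \<open>Coordinates of a cell are numbered \<open>0, \<dots>, n - 1\<close>.\<close>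

definition DConf :: "nat set set \<Rightarrow> nat \<Rightarrow> cell set" where
  "DConf K n =
     {\<alpha>. length \<alpha> = n \<and> set \<alpha> \<subseteq> K \<and> (\<forall>i < n. \<forall>j < n. i \<noteq> j \<longrightarrow> \<alpha> ! i \<inter> \<alpha> ! j = {})}"

definition cell_dim :: "cell \<Rightarrow> nat" where
  "cell_dim \<alpha> = (\<Sum>\<sigma>\<leftarrow>\<alpha>. card \<sigma> - 1)"

definition DConf_hasse :: "nat set set \<Rightarrow> nat \<Rightarrow> (cell \<times> cell) set" where
  "DConf_hasse K n =
     {(\<alpha>, \<beta>). \<alpha> \<in> DConf K n \<and> \<beta> \<in> DConf K n \<and>
        list_all2 (\<subseteq>) \<beta> \<alpha> \<and> cell_dim \<alpha> = Suc (cell_dim \<beta>)}"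

text \<open>The supremum is \<open>0\<close> if there are no cells; the construction below then yields \<open>{}\<close>.\<close>

definition DConf_dim :: "nat set set \<Rightarrow> nat \<Rightarrow> nat" where
  "DConf_dim K n = Sup (cell_dim ` DConf K n)"

definition addable :: "nat \<Rightarrow> nat set set \<Rightarrow> cell \<Rightarrow> nat \<Rightarrow> nat \<Rightarrow> bool" where
  "addable m K \<alpha> i v \<longleftrightarrow> v \<in> {1..m} - \<Union> (set \<alpha>) \<and> insert v (\<alpha> ! i) \<in> K"

definition add_vertex :: "cell \<Rightarrow> nat \<Rightarrow> nat \<Rightarrow> cell" where
  "add_vertex \<alpha> i v = \<alpha>[i := insert v (\<alpha> ! i)]"


section \<open>The order on cells\<close>

text \<open>\<^const>\<open>lenlex\<close> compares lengths first and lists of equal length lexicographically.\<close>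

definition simplex_order :: "(nat set \<times> nat set) set" where
  "simplex_order = inv_image (lenlex less_than) sorted_list_of_set"

definition cell_order :: "(cell \<times> cell) set" where
  "cell_order = lexord simplex_order"

definition cells_increasing :: "cell set \<Rightarrow> cell list" where
  "cells_increasing A = (THE xs. set xs = A \<and> sorted_wrt (\<lambda>\<alpha> \<beta>. (\<alpha>, \<beta>) \<in> cell_order) xs)"


section \<open>The algorithm\<close>

text \<open>
  A state consists of the edges chosen so far and, for each \<open>p\<close>, the available \<open>p\<close>-cells.  The
  edge recorded for \<open>\<alpha> \<nearrow> add_vertex \<alpha> r u\<close> is the underlying edge
  \<open>add_vertex \<alpha> r u \<searrow> \<alpha>\<close> of the Hasse diagram; reversing it is left to
  \<^const>\<open>modified_hasse\<close>.
\<close>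

type_synonym state = "(cell \<times> cell) set \<times> (nat \<Rightarrow> cell set)"

definition try_cell ::
  "nat \<Rightarrow> nat set set \<Rightarrow> nat \<Rightarrow> nat \<Rightarrow> nat \<Rightarrow> cell \<Rightarrow> state \<Rightarrow> state" where
  "try_cell m K p r u \<alpha> = (\<lambda>(W, A).
     if addable m K \<alpha> r u \<and> \<alpha> \<in> A p \<and> add_vertex \<alpha> r u \<in> A (Suc p)
     then (insert (add_vertex \<alpha> r u, \<alpha>) W,
           A(p := A p - {\<alpha>}, Suc p := A (Suc p) - {add_vertex \<alpha> r u}))
     else (W, A))"

text \<open>
  Listing the available \<open>p\<close>-cells once, before the innermost loop, is harmless: the body of that
  loop can only remove from them the cell currently being visited.
\<close>

definition loop_cells ::
  "nat \<Rightarrow> nat set set \<Rightarrow> nat \<Rightarrow> nat \<Rightarrow> nat \<Rightarrow> state \<Rightarrow> state" where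
  "loop_cells m K p r u = (\<lambda>(W, A).
     fold (try_cell m K p r u) (cells_increasing (A p)) (W, A))"

definition loop_vertices :: "nat \<Rightarrow> nat set set \<Rightarrow> nat \<Rightarrow> nat \<Rightarrow> state \<Rightarrow> state" where
  "loop_vertices m K p r = fold (loop_cells m K p r) (rev [1..<Suc m])"

definition loop_coordinates ::
  "nat \<Rightarrow> nat set set \<Rightarrow> nat \<Rightarrow> nat \<Rightarrow> state \<Rightarrow> state" where
  "loop_coordinates m K n p = (\<lambda>(W, A).
     if A p \<noteq> {} \<and> A (Suc p) \<noteq> {}
     then fold (loop_vertices m K p) (rev [0..<n]) (W, A)
     else (W, A))"

definition W_field :: "nat \<Rightarrow> nat set set \<Rightarrow> nat \<Rightarrow> (cell \<times> cell) set" where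
  "W_field m K n =
     fst (fold (loop_coordinates m K n) (rev [0..<DConf_dim K n])
           ({}, \<lambda>p. {\<alpha> \<in> DConf K n. cell_dim \<alpha> = p}))"


section \<open>Enumeration in increasing order is well defined\<close>

lemma simplex_order_trans: "trans simplex_order"
  unfolding simplex_order_def by (intro trans_inv_image lenlex_transI trans_less_than)

lemma cell_order_trans: "trans cell_order"
  unfolding cell_order_def by (intro lexord_transI simplex_order_trans)

lemma cell_order_irrefl: "(\<alpha>, \<alpha>) \<notin> cell_order"
  unfolding cell_order_def simplex_order_def
  by (rule lexord_irreflexive) (simp add: lenlex_irreflexive)

lemma simplex_order_total:
  assumes "finite \<sigma>" "finite \<tau>" "\<sigma> \<noteq> \<tau>"
  shows "(\<sigma>, \<tau>) \<in> simplex_order \<or> (\<tau>, \<sigma>) \<in> simplex_order"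
proof -
  have "sorted_list_of_set \<sigma> \<noteq> sorted_list_of_set \<tau>"
    using assms by (metis set_sorted_list_of_set)
  moreover have "total (lenlex less_than)"
    by (rule total_lenlex) (auto simp: total_on_def)
  ultimately show ?thesis
    by (simp add: simplex_order_def total_on_def)
qed

lemma cell_order_total:
  assumes "length \<alpha> = length \<beta>" "\<forall>\<sigma> \<in> set \<alpha> \<union> set \<beta>. finite \<sigma>" "\<alpha> \<noteq> \<beta>"
  shows "(\<alpha>, \<beta>) \<in> cell_order \<or> (\<beta>, \<alpha>) \<in> cell_order"
  using assms
proof (induction \<alpha> \<beta> rule: list_induct2)
  case (Cons \<sigma> \<alpha> \<tau> \<beta>)
  then show ?case
    using simplex_order_total[of \<sigma> \<tau>] by (auto simp: cell_order_def)
qed simp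

theorem cells_increasing_ex1:
  assumes "finite A" "A \<subseteq> DConf K n" "\<forall>\<sigma> \<in> K. finite \<sigma>"
  shows "\<exists>!xs. set xs = A \<and> sorted_wrt (\<lambda>\<alpha> \<beta>. (\<alpha>, \<beta>) \<in> cell_order) xs"
proof (rule ex_ex1I)
  have tot: "(\<alpha>, \<beta>) \<in> cell_order \<or> (\<beta>, \<alpha>) \<in> cell_order"
    if "\<alpha> \<in> DConf K n" "\<beta> \<in> DConf K n" "\<alpha> \<noteq> \<beta>" for \<alpha> \<beta>
    using that assms(3) by (intro cell_order_total) (auto simp: DConf_def)
  show "\<exists>xs. set xs = A \<and> sorted_wrt (\<lambda>\<alpha> \<beta>. (\<alpha>, \<beta>) \<in> cell_order) xs"
    using assms(1,2)
  proof (induction A rule: finite_induct)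
    case (insert \<gamma> A)
    then obtain xs where xs: "set xs = A" "sorted_wrt (\<lambda>\<alpha> \<beta>. (\<alpha>, \<beta>) \<in> cell_order) xs"
      by auto
    let ?ys = "filter (\<lambda>\<alpha>. (\<alpha>, \<gamma>) \<in> cell_order) xs @ \<gamma> # filter (\<lambda>\<alpha>. (\<gamma>, \<alpha>) \<in> cell_order) xs"
    have "set ?ys = insert \<gamma> A"
      using xs(1) insert.prems insert.hyps(2) tot[of _ \<gamma>] by auto
    moreover have "sorted_wrt (\<lambda>\<alpha> \<beta>. (\<alpha>, \<beta>) \<in> cell_order) ?ys"
      using xs(2) cell_order_trans by (auto simp: sorted_wrt_append sorted_wrt_filter dest: transD)
    ultimately show ?case by blast
  qed simp
  fix xs ys
  assume "set xs = A \<and> sorted_wrt (\<lambda>\<alpha> \<beta>. (\<alpha>, \<beta>) \<in> cell_order) xs"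
    and "set ys = A \<and> sorted_wrt (\<lambda>\<alpha> \<beta>. (\<alpha>, \<beta>) \<in> cell_order) ys"
  then have "set xs = set ys" "sorted_wrt (\<lambda>\<alpha> \<beta>. (\<alpha>, \<beta>) \<in> cell_order) xs"
    "sorted_wrt (\<lambda>\<alpha> \<beta>. (\<alpha>, \<beta>) \<in> cell_order) ys" by auto
  then show "xs = ys"
  proof (induction xs arbitrary: ys)
    case (Cons x xs)
    then obtain y ys' where ys: "ys = y # ys'" by (cases ys) auto
    have "x = y"
      using Cons.prems cell_order_irrefl cell_order_trans unfolding ys
      by simp (metis insert_iff transD)
    moreover have "x \<notin> set xs" "y \<notin> set ys'"
      using Cons.prems cell_order_irrefl unfolding ys by auto
    ultimately show ?case
      using Cons.prems Cons.IH[of ys'] unfolding ys by (simp add: insert_ident)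
  qed simp
qed

end

theory Submission
  imports Defs "HOL-Library.Product_Lexorder"
begin

text \<open>
  Each edge \<open>\<alpha> \<nearrow> \<alpha> +\<^sub>r u\<close> of the field is chosen at the time \<open>(dim \<alpha>, r, u)\<close>, and the
  algorithm is a greedy matching that runs through these triples in decreasing lexicographic
  order.  Take an edge of maximal triple \<open>(p, r, u)\<close> on a cycle.  The vertex \<open>u\<close>, having entered
  coordinate \<open>r\<close>, has to leave it again at some step \<open>\<beta> \<searrow> \<alpha>\<close>, so \<open>\<beta> = \<alpha> +\<^sub>r u\<close>.  The field edges
  at \<open>\<beta>\<close> and at \<open>\<alpha>\<close> lie on the cycle and have a smaller triple, so both cells were
  still available at time \<open>(p, r, u)\<close>, and the algorithm would have matched them.
\<close>

section \<open>Facets of cells\<close>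

lemma DConf_iff:
  "\<alpha> \<in> DConf K n \<longleftrightarrow>
     length \<alpha> = n \<and> (\<forall>i<n. \<alpha> ! i \<in> K) \<and> (\<forall>i<n. \<forall>j<n. i \<noteq> j \<longrightarrow> \<alpha> ! i \<inter> \<alpha> ! j = {})"
  by (auto simp: DConf_def in_set_conv_nth subset_iff)

lemma simplicial_complex_on_simplex:
  assumes "simplicial_complex_on m K" "\<sigma> \<in> K"
  shows "finite \<sigma>" "\<sigma> \<noteq> {}"
  using assms unfolding simplicial_complex_on_def
  by (meson PowD finite_atLeastAtMost finite_subset subsetD, blast)

lemma finite_DConf:
  assumes "simplicial_complex_on m K"
  shows "finite (DConf K n)"
proof -
  have "finite K"
    using assms unfolding simplicial_complex_on_def
    by (meson finite_Pow_iff finite_atLeastAtMost finite_subset)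
  then show ?thesis
    by (rule finite_subset[rotated, OF finite_lists_length_eq[of K n]]) (auto simp: DConf_def)
qed

lemma cell_dim_sum: "cell_dim \<alpha> = (\<Sum>i<length \<alpha>. card (\<alpha> ! i) - 1)"
  by (simp add: cell_dim_def sum_list_sum_nth atLeast0LessThan)

lemma cell_dim_add_vertex:
  assumes "r < length \<alpha>" "finite (\<alpha> ! r)" "\<alpha> ! r \<noteq> {}" "u \<notin> \<alpha> ! r"
  shows "cell_dim (add_vertex \<alpha> r u) = Suc (cell_dim \<alpha>)"
proof -
  \<comment> \<open>Each coordinate contributes the truncated difference \<open>card - 1\<close>,
    which would stay 0 on passing from the empty set to a singleton.\<close>
  have "card (\<alpha> ! r) > 0"
    using assms by (simp add: card_gt_0_iff)
  then show ?thesis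
    using assms
    by (simp add: cell_dim_sum add_vertex_def sum.remove[of "{..<length \<alpha>}" r])
qed

text \<open>Deleting \<open>u\<close> from coordinate \<open>r\<close> recovers the cell. Hence two
  candidates with the same \<open>r\<close> and \<open>u\<close> cannot compete for one upper
  cell.\<close>

lemma add_vertex_inject:
  assumes "add_vertex \<alpha> r u = add_vertex \<beta> r u" "r < length \<alpha>" "u \<notin> \<alpha> ! r" "u \<notin> \<beta> ! r"
  shows "\<alpha> = \<beta>"
proof (rule nth_equalityI)
  show len: "length \<alpha> = length \<beta>"
    using arg_cong[OF assms(1), of length] by (simp add: add_vertex_def)
  fix i assume "i < length \<alpha>"
  then show "\<alpha> ! i = \<beta> ! i"
    using arg_cong[OF assms(1), of "\<lambda>\<gamma>. \<gamma> ! i"] assms(2-) len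
    by (cases "i = r") (auto simp: add_vertex_def insert_ident)
qed

lemma DConf_hasse_subset:
  assumes "(\<beta>, \<alpha>) \<in> DConf_hasse K n" "i < n"
  shows "\<alpha> ! i \<subseteq> \<beta> ! i"
  using assms by (auto simp: DConf_hasse_def DConf_iff list_all2_conv_all_nth)

lemma DConf_hasse_cell_dim:
  "(\<beta>, \<alpha>) \<in> DConf_hasse K n \<Longrightarrow> cell_dim \<beta> = Suc (cell_dim \<alpha>)"
  by (simp add: DConf_hasse_def)

text \<open>No coordinate shrinks from \<alpha> to \<beta> and coordinate \<open>r\<close> grows
  strictly, so the single unit of dimension is spent there and all other coordinates agree.
  Disjointness inside \<beta> keeps \<open>u\<close> out of the rest of \<alpha>.\<close>

lemma DConf_hasse_add_vertex:
  assumes K: "simplicial_complex_on m K"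
    and edge: "(\<beta>, \<alpha>) \<in> DConf_hasse K n"
    and r: "r < n" "u \<in> \<beta> ! r" "u \<notin> \<alpha> ! r"
  shows "\<beta> = add_vertex \<alpha> r u" "addable m K \<alpha> r u"
proof -
  note fin = simplicial_complex_on_simplex[OF K]
  have \<alpha>: "length \<alpha> = n" "\<And>i. i < n \<Longrightarrow> \<alpha> ! i \<in> K"
    and \<beta>: "length \<beta> = n" "\<And>i. i < n \<Longrightarrow> \<beta> ! i \<in> K"
    and dis: "\<And>i j. i < n \<Longrightarrow> j < n \<Longrightarrow> i \<noteq> j \<Longrightarrow> \<beta> ! i \<inter> \<beta> ! j = {}"
    using edge by (auto simp: DConf_hasse_def DConf_iff)
  note sub = DConf_hasse_subset[OF edge]
  let ?a = "\<lambda>i. card (\<alpha> ! i) - 1" and ?b = "\<lambda>i. card (\<beta> ! i) - 1"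
  have le: "card (\<alpha> ! i) \<le> card (\<beta> ! i)" if "i < n" for i
    by (rule card_mono) (use that sub fin \<beta> in auto)
  have pos: "card (\<alpha> ! i) > 0" if "i < n" for i
    using that fin \<alpha> by (simp add: card_gt_0_iff)
  have lt: "card (\<alpha> ! r) < card (\<beta> ! r)"
    by (rule psubset_card_mono) (use r sub fin \<beta> in auto)
  have dim: "(\<Sum>i<n. ?b i) = Suc (\<Sum>i<n. ?a i)"
    using DConf_hasse_cell_dim[OF edge] \<alpha>(1) \<beta>(1) by (simp add: cell_dim_sum)
  have split: "(\<Sum>i<n. f i) = f r + (\<Sum>i\<in>{..<n} - {r}. f i)" for f :: "nat \<Rightarrow> nat"
    using r(1) by (simp add: sum.remove)
  have rest_le: "(\<Sum>i\<in>{..<n} - {r}. ?a i) \<le> (\<Sum>i\<in>{..<n} - {r}. ?b i)"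
    by (rule sum_mono) (use le in \<open>simp add: diff_le_mono\<close>)
  have card_r: "card (\<beta> ! r) = Suc (card (\<alpha> ! r))"
    and rest: "(\<Sum>i\<in>{..<n} - {r}. ?a i) = (\<Sum>i\<in>{..<n} - {r}. ?b i)"
    using dim split[of ?a] split[of ?b] rest_le lt pos[OF r(1)] by linarith+
  have other: "\<beta> ! i = \<alpha> ! i" if i: "i < n" "i \<noteq> r" for i
  proof -
    have "?a i = ?b i"
    proof (rule ccontr)
      assume "?a i \<noteq> ?b i"
      then have "(\<Sum>i\<in>{..<n} - {r}. ?a i) < (\<Sum>i\<in>{..<n} - {r}. ?b i)"
        using i le[OF i(1)] by (intro sum_strict_mono_ex1) (auto simp: diff_le_mono le nat_less_le)
      with rest show False by simp
    qed
    then have "card (\<alpha> ! i) = card (\<beta> ! i)"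
      using le[OF i(1)] pos[OF i(1)] by linarith
    then show ?thesis
      using card_subset_eq[OF fin(1)[OF \<beta>(2)[OF i(1)]] sub[OF i(1)]] by simp
  qed
  have br: "\<beta> ! r = insert u (\<alpha> ! r)"
  proof (rule card_subset_eq[symmetric])
    show "card (insert u (\<alpha> ! r)) = card (\<beta> ! r)"
      using r fin(1)[OF \<alpha>(2)[OF r(1)]] card_r by simp
  qed (use r sub fin \<beta> in auto)
  show "\<beta> = add_vertex \<alpha> r u"
    by (rule nth_equalityI) (auto simp: add_vertex_def r(1) \<alpha> \<beta> nth_list_update br other)
  have "u \<notin> \<alpha> ! i" if "i < n" for i
    using that r dis[OF r(1), of i] sub[OF that] by (cases "i = r") auto
  moreover have "u \<in> {1..m}"
    using K \<beta>(2)[OF r(1)] r(2) unfolding simplicial_complex_on_def by blast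
  ultimately show "addable m K \<alpha> r u"
    using \<beta>(2)[OF r(1)] \<alpha>(1) by (auto simp: addable_def br in_set_conv_nth)
qed


section \<open>The algorithm as a greedy matching\<close>

definition candidates :: "nat \<Rightarrow> nat set set \<Rightarrow> nat \<Rightarrow> (nat \<times> nat \<times> cell) set" where
  "candidates m K n = {(r, u, \<alpha>). r < n \<and> \<alpha> \<in> DConf K n \<and> addable m K \<alpha> r u}"

fun candidate_edge :: "nat \<times> nat \<times> cell \<Rightarrow> cell \<times> cell" where
  "candidate_edge (r, u, \<alpha>) = (add_vertex \<alpha> r u, \<alpha>)"

text \<open>The time of a trial, larger keys coming earlier. All cells of one innermost loop share a
  key, but touching candidates with equal keys coincide, so a key is fine enough.\<close>

fun candidate_key :: "nat \<times> nat \<times> cell \<Rightarrow> nat \<times> nat \<times> nat" where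
  "candidate_key (r, u, \<alpha>) = (cell_dim \<alpha>, r, u)"

definition touching :: "'c \<times> 'c \<Rightarrow> 'c \<times> 'c \<Rightarrow> bool" where
  "touching e e' \<longleftrightarrow> {fst e, snd e} \<inter> {fst e', snd e'} \<noteq> {}"

text \<open>
  \<open>C\<close> is the set of candidates tried so far.  A rejected candidate is blocked by an edge that was
  chosen no later, which is the last condition.
\<close>

fun greedy_state ::
  "nat \<Rightarrow> nat set set \<Rightarrow> nat \<Rightarrow> (nat \<times> nat \<times> cell) set \<Rightarrow> state \<Rightarrow> bool" where
  "greedy_state m K n C (W, A) \<longleftrightarrow>
     C \<subseteq> candidates m K n \<and> W \<subseteq> candidate_edge ` C \<and>
     (\<forall>e\<in>W. \<forall>e'\<in>W. touching e e' \<longrightarrow> e = e') \<and>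
     (\<forall>p. A p = {\<alpha> \<in> DConf K n. cell_dim \<alpha> = p \<and> \<alpha> \<notin> Field W}) \<and>
     (\<forall>c\<in>C. \<exists>c'\<in>C. candidate_edge c' \<in> W \<and> touching (candidate_edge c) (candidate_edge c') \<and>
        candidate_key c \<le> candidate_key c')"

lemma greedy_stateD:
  assumes "greedy_state m K n C (W, A)"
  shows "C \<subseteq> candidates m K n" "W \<subseteq> candidate_edge ` C"
    "\<And>e e'. e \<in> W \<Longrightarrow> e' \<in> W \<Longrightarrow> touching e e' \<Longrightarrow> e = e'"
    "\<And>p. A p = {\<alpha> \<in> DConf K n. cell_dim \<alpha> = p \<and> \<alpha> \<notin> Field W}"
    "\<And>c. c \<in> C \<Longrightarrow> \<exists>c'\<in>C. candidate_edge c' \<in> W \<and>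
       touching (candidate_edge c) (candidate_edge c') \<and> candidate_key c \<le> candidate_key c'"
  using assms unfolding greedy_state.simps by meson+

text \<open>Invariant rule for a descending loop: \<open>P i\<close> holds once index
  \<open>i\<close> has been processed, so \<open>P b\<close> is the state before the first
  pass.\<close>

lemma fold_rev_upt_induct:
  assumes "a \<le> b" "P b s" "\<And>i s. a \<le> i \<Longrightarrow> i < b \<Longrightarrow> P (Suc i) s \<Longrightarrow> P i (f i s)"
  shows "P a (fold f (rev [a..<b]) s)"
  using assms by (induction b arbitrary: s rule: dec_induct) auto

lemma Field_iff_fst_snd: "v \<in> Field W \<longleftrightarrow> (\<exists>e\<in>W. v = fst e \<or> v = snd e)"
  by (auto simp: Field_def) force+

context
  fixes m n :: nat and K :: "nat set set"
  assumes complex: "simplicial_complex_on m K"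
begin

section \<open>Candidates, their edges and their keys\<close>

lemma candidateD:
  assumes "(r, u, \<alpha>) \<in> candidates m K n"
  shows "(add_vertex \<alpha> r u, \<alpha>) \<in> DConf_hasse K n" "u \<notin> \<alpha> ! r" "r < n" "u \<in> {1..m}"
proof -
  from assms have r: "r < n" and \<alpha>: "\<alpha> \<in> DConf K n" and add: "addable m K \<alpha> r u"
    by (auto simp: candidates_def)
  then have len: "length \<alpha> = n" and K: "\<And>i. i < n \<Longrightarrow> \<alpha> ! i \<in> K"
    and u: "\<And>i. i < n \<Longrightarrow> u \<notin> \<alpha> ! i"
    by (auto simp: DConf_iff addable_def)
  show "u \<notin> \<alpha> ! r" "r < n" "u \<in> {1..m}"
    using r u add by (auto simp: addable_def)
  have "add_vertex \<alpha> r u \<in> DConf K n"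
    using \<alpha> add r u by (auto simp: DConf_iff add_vertex_def addable_def nth_list_update)
  moreover have "cell_dim (add_vertex \<alpha> r u) = Suc (cell_dim \<alpha>)"
    using r u len K simplicial_complex_on_simplex[OF complex] by (simp add: cell_dim_add_vertex)
  moreover have "list_all2 (\<subseteq>) \<alpha> (add_vertex \<alpha> r u)"
    using r len by (auto simp: list_all2_conv_all_nth add_vertex_def nth_list_update)
  ultimately show "(add_vertex \<alpha> r u, \<alpha>) \<in> DConf_hasse K n"
    using \<alpha> by (simp add: DConf_hasse_def)
qed

text \<open>The lower end of the edge is \<alpha>, and \<open>r\<close> and \<open>u\<close> are
  read off from the only place where the upper end differs from it.\<close>

lemma inj_on_candidate_edge: "inj_on candidate_edge (candidates m K n)"
proof (rule inj_onI)
  fix c c' assume c: "c \<in> candidates m K n" "c' \<in> candidates m K n"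
    and eq: "candidate_edge c = candidate_edge c'"
  obtain r u \<alpha> r' u' where cc: "c = (r, u, \<alpha>)" "c' = (r', u', \<alpha>)"
    using eq by (cases c; cases c') auto
  note cD = candidateD[OF c(1)[unfolded cc]] candidateD[OF c(2)[unfolded cc]]
  have len: "length \<alpha> = n"
    using cD(1) by (simp add: DConf_hasse_def DConf_iff)
  have \<beta>: "add_vertex \<alpha> r u ! i = add_vertex \<alpha> r' u' ! i" for i
    using eq by (simp add: cc)
  have "r = r'"
    using \<beta>[of r] cD len by (cases "r = r'") (auto simp: add_vertex_def)
  then show "c = c'"
    using \<beta>[of r] cD len by (auto simp: cc add_vertex_def)
qed

lemma candidates_key:
  assumes "c \<in> candidates m K n"
  obtains p r u where "candidate_key c = (p, r, u)" "r < n" "1 \<le> u" "u \<le> m" "p < DConf_dim K n"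
proof -
  obtain r u \<alpha> where c: "c = (r, u, \<alpha>)" by (cases c)
  note cD = candidateD[OF assms[unfolded c]]
  \<comment> \<open>The upper cell is a cell of dimension one more, so the outer loop may start at
    \<open>DConf_dim K n - 1\<close> without missing a candidate.\<close>
  have "Suc (cell_dim \<alpha>) \<in> cell_dim ` DConf K n"
    using cD(1) by (auto simp: DConf_hasse_def intro: rev_image_eqI)
  then have "Suc (cell_dim \<alpha>) \<le> DConf_dim K n"
    unfolding DConf_dim_def by (rule le_cSup_finite[rotated]) (simp add: finite_DConf[OF complex])
  with cD show thesis
    by (intro that[of "cell_dim \<alpha>" r u]) (auto simp: c)
qed

section \<open>Preservation of the invariant by trials\<close>

lemma greedy_state_skip:
  assumes g: "greedy_state m K n C (W, A)" and D: "D \<subseteq> candidates m K n"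
    and key: "\<And>c d. c \<in> C \<Longrightarrow> d \<in> D \<Longrightarrow> candidate_key d \<le> candidate_key c"
    and unavailable: "\<And>r u \<alpha>. (r, u, \<alpha>) \<in> D \<Longrightarrow>
      \<alpha> \<notin> A (cell_dim \<alpha>) \<or> add_vertex \<alpha> r u \<notin> A (Suc (cell_dim \<alpha>))"
  shows "greedy_state m K n (C \<union> D) (W, A)"
proof -
  note gD = greedy_stateD[OF g]
  have new: "\<exists>c\<in>C. candidate_edge c \<in> W \<and> touching (candidate_edge d) (candidate_edge c) \<and>
      candidate_key d \<le> candidate_key c" if d: "d \<in> D" for d
  proof -
    obtain r u \<alpha> where dd: "d = (r, u, \<alpha>)" by (cases d)
    have "(add_vertex \<alpha> r u, \<alpha>) \<in> DConf_hasse K n"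
      using candidateD(1) d dd D by blast
    then have "\<alpha> \<in> Field W \<or> add_vertex \<alpha> r u \<in> Field W"
      using unavailable[of r u \<alpha>] d unfolding dd gD(4) by (auto simp: DConf_hasse_def)
    then obtain e where e: "e \<in> W" "touching (candidate_edge d) e"
      unfolding Field_iff_fst_snd by (auto simp: dd touching_def)
    with gD(2) obtain c where "c \<in> C" "e = candidate_edge c" by blast
    with e key[OF _ d] show ?thesis by blast
  qed
  show ?thesis
    unfolding greedy_state.simps
  proof (intro conjI)
    show "C \<union> D \<subseteq> candidates m K n" "W \<subseteq> candidate_edge ` (C \<union> D)"
      using gD(1,2) D by blast+
    show "\<forall>c\<in>C \<union> D. \<exists>c'\<in>C \<union> D. candidate_edge c' \<in> W \<and>
        touching (candidate_edge c) (candidate_edge c') \<and> candidate_key c \<le> candidate_key c'"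
      using gD(5) new by blast
  qed (use gD(3,4) in blast)+
qed

text \<open>Availability puts both ends outside \<open>Field W\<close>, so the new edge touches no
  old one; it serves as its own blocker, and old blockers remain.\<close>

lemma greedy_state_match:
  assumes g: "greedy_state m K n C (W, A)" and c: "(r, u, \<alpha>) \<in> candidates m K n"
    and p: "\<alpha> \<in> A p" "add_vertex \<alpha> r u \<in> A (Suc p)"
  shows "greedy_state m K n (insert (r, u, \<alpha>) C) (insert (add_vertex \<alpha> r u, \<alpha>) W,
           A(p := A p - {\<alpha>}, Suc p := A (Suc p) - {add_vertex \<alpha> r u}))"
proof -
  let ?e = "(add_vertex \<alpha> r u, \<alpha>)"
  note gD = greedy_stateD[OF g]
  note A = gD(4)
  have free: "\<alpha> \<notin> Field W" "add_vertex \<alpha> r u \<notin> Field W"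
    and dim: "cell_dim \<alpha> = p" "cell_dim (add_vertex \<alpha> r u) = Suc p"
    using p unfolding A by auto
  have new: "\<not> touching ?e e" "\<not> touching e ?e" if "e \<in> W" for e
    using that free unfolding Field_iff_fst_snd touching_def by auto
  have "(A(p := A p - {\<alpha>}, Suc p := A (Suc p) - {add_vertex \<alpha> r u})) q =
      {\<alpha> \<in> DConf K n. cell_dim \<alpha> = q \<and> \<alpha> \<notin> Field (insert ?e W)}" for q
    using dim by (auto simp: A)
  moreover have "\<forall>e\<in>insert ?e W. \<forall>e'\<in>insert ?e W. touching e e' \<longrightarrow> e = e'"
    using gD(3) new by blast
  moreover have "\<exists>c'\<in>insert (r, u, \<alpha>) C. candidate_edge c' \<in> insert ?e W \<and>
      touching (candidate_edge c) (candidate_edge c') \<and> candidate_key c \<le> candidate_key c'"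
    if "c \<in> insert (r, u, \<alpha>) C" for c
  proof (cases "c = (r, u, \<alpha>)")
    case True
    then show ?thesis by (intro bexI[of _ c]) (simp_all add: touching_def)
  next
    case False
    with that show ?thesis using gD(5)[of c] by blast
  qed
  moreover have "insert (r, u, \<alpha>) C \<subseteq> candidates m K n"
    using gD(1) c by blast
  moreover have "insert ?e W \<subseteq> candidate_edge ` insert (r, u, \<alpha>) C"
    using gD(2) by auto
  ultimately show ?thesis
    unfolding greedy_state.simps by blast
qed

text \<open>Intersecting with \<open>candidates\<close> covers the case that \<open>u\<close> cannot
  be added: then neither the state nor the set of tried candidates changes.\<close>

lemma greedy_state_try_cell:
  assumes g: "greedy_state m K n C s" and \<alpha>: "\<alpha> \<in> DConf K n" "r < n"
    and key: "\<And>c. c \<in> C \<Longrightarrow> (cell_dim \<alpha>, r, u) \<le> candidate_key c"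
  shows "greedy_state m K n (C \<union> ({(r, u, \<alpha>)} \<inter> candidates m K n))
           (try_cell m K (cell_dim \<alpha>) r u \<alpha> s)"
proof -
  obtain W A where s: "s = (W, A)" by (cases s)
  show ?thesis
  proof (cases "addable m K \<alpha> r u \<and> \<alpha> \<in> A (cell_dim \<alpha>) \<and>
      add_vertex \<alpha> r u \<in> A (Suc (cell_dim \<alpha>))")
    case True
    then have c: "(r, u, \<alpha>) \<in> candidates m K n"
      using \<alpha> by (simp add: candidates_def)
    then have "C \<union> ({(r, u, \<alpha>)} \<inter> candidates m K n) = insert (r, u, \<alpha>) C" by auto
    then show ?thesis
      using greedy_state_match[OF g[unfolded s] c] True by (simp add: try_cell_def s del: greedy_state.simps)
  next
    case False
    have "greedy_state m K n (C \<union> ({(r, u, \<alpha>)} \<inter> candidates m K n)) (W, A)"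
      by (rule greedy_state_skip[OF g[unfolded s]]) (use False key in \<open>auto simp: candidates_def\<close>)
    then show ?thesis
      using False by (auto simp add: try_cell_def s simp del: greedy_state.simps)
  qed
qed

text \<open>All listed cells give the same key \<open>(p, r, u)\<close>, so the bound on the keys of
  tried candidates persists along the list.\<close>

lemma greedy_state_fold_try_cell:
  assumes "greedy_state m K n C s" "r < n"
    and "\<And>\<alpha>. \<alpha> \<in> set xs \<Longrightarrow> \<alpha> \<in> DConf K n \<and> cell_dim \<alpha> = p"
    and "\<And>c. c \<in> C \<Longrightarrow> (p, r, u) \<le> candidate_key c"
  shows "greedy_state m K n (C \<union> ({(r, u, \<alpha>) |\<alpha>. \<alpha> \<in> set xs} \<inter> candidates m K n))
           (fold (try_cell m K p r u) xs s)"
  using assms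
proof (induction xs arbitrary: C s)
  case (Cons \<alpha> xs)
  let ?C = "C \<union> ({(r, u, \<alpha>)} \<inter> candidates m K n)"
  have "greedy_state m K n ?C (try_cell m K p r u \<alpha> s)"
    using greedy_state_try_cell[OF Cons.prems(1), of \<alpha> r u] Cons.prems(2-) by auto
  moreover have "(p, r, u) \<le> candidate_key c" if "c \<in> ?C" for c
    using that Cons.prems(3)[of \<alpha>] Cons.prems(4)[of c] by auto
  ultimately have "greedy_state m K n (?C \<union> ({(r, u, \<alpha>) |\<alpha>. \<alpha> \<in> set xs} \<inter> candidates m K n))
      (fold (try_cell m K p r u) (\<alpha> # xs) s)"
    using Cons.IH[of ?C] Cons.prems(2,3) by simp
  moreover have "?C \<union> ({(r, u, \<alpha>) |\<alpha>. \<alpha> \<in> set xs} \<inter> candidates m K n) =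
      C \<union> ({(r, u, \<beta>) |\<beta>. \<beta> \<in> set (\<alpha> # xs)} \<inter> candidates m K n)"
    by auto
  ultimately show ?case by simp
qed simp

section \<open>The nested loops as a descending sweep through the keys\<close>

text \<open>What has been tried once the loops have come down to key \<open>k\<close>.\<close>

definition candidates_from :: "nat \<times> nat \<times> nat \<Rightarrow> (nat \<times> nat \<times> cell) set" where
  "candidates_from k = {c \<in> candidates m K n. k \<le> candidate_key c}"

text \<open>Only keys within the loop ranges occur, so bounds may be moved across out-of-range
  values. This links the end of one loop to the start of the next.\<close>

lemma candidates_from_eqI:
  assumes "\<And>p r u. r < n \<Longrightarrow> 1 \<le> u \<Longrightarrow> u \<le> m \<Longrightarrow> p < DConf_dim K n \<Longrightarrow>
    k \<le> (p, r, u) \<longleftrightarrow> k' \<le> (p, r, u)"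
  shows "candidates_from k = candidates_from k'"
  unfolding candidates_from_def using assms candidates_key by (metis (lifting))

lemma greedy_state_loop_cells:
  assumes g: "greedy_state m K n (candidates_from (p, r, Suc u)) s" and r: "r < n"
  shows "greedy_state m K n (candidates_from (p, r, u)) (loop_cells m K p r u s)"
proof -
  obtain W A where s: "s = (W, A)" by (cases s)
  let ?C = "candidates_from (p, r, Suc u)"
  let ?D = "{(r, u, \<alpha>) |\<alpha>. cell_dim \<alpha> = p \<and> \<alpha> \<notin> A p} \<inter> candidates m K n"
  let ?E = "{(r, u, \<alpha>) |\<alpha>. \<alpha> \<in> A p} \<inter> candidates m K n"
  have A: "A p \<subseteq> DConf K n" "\<And>\<alpha>. \<alpha> \<in> A p \<Longrightarrow> cell_dim \<alpha> = p"
    using g by (auto simp: s)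
  have "finite (A p)"
    using A(1) finite_DConf[OF complex] by (rule finite_subset)
  then have xs: "set (cells_increasing (A p)) = A p"
    using theI'[OF cells_increasing_ex1[of "A p" K n]] A(1)
      simplicial_complex_on_simplex(1)[OF complex]
    unfolding cells_increasing_def by blast
  have key: "(p, r, u) \<le> candidate_key c" if "c \<in> ?C" for c
    using that by (auto simp: candidates_from_def intro: order_trans[rotated])
  \<comment> \<open>Candidates in \<open>?D\<close> have this key but a lower cell that is already
    gone, so the enumeration never visits them; they count as tried before the fold starts.\<close>
  have "greedy_state m K n (?C \<union> ?D) (W, A)"
    by (rule greedy_state_skip[OF g[unfolded s]]) (use key in auto)
  then have "greedy_state m K n (?C \<union> ?D \<union>
      ({(r, u, \<alpha>) |\<alpha>. \<alpha> \<in> set (cells_increasing (A p))} \<inter> candidates m K n))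
      (fold (try_cell m K p r u) (cells_increasing (A p)) (W, A))"
    by (rule greedy_state_fold_try_cell) (use A r key xs in auto)
  then have "greedy_state m K n (?C \<union> ?D \<union> ?E) (loop_cells m K p r u s)"
    by (simp add: loop_cells_def s xs del: greedy_state.simps)
  moreover have "?C \<union> ?D \<union> ?E = candidates_from (p, r, u)"
    using A(2) by (auto simp: candidates_from_def)
  ultimately show ?thesis by simp
qed

lemma greedy_state_loop_vertices:
  assumes g: "greedy_state m K n (candidates_from (p, Suc r, 0)) s" and r: "r < n"
  shows "greedy_state m K n (candidates_from (p, r, 0)) (loop_vertices m K p r s)"
proof -
  \<comment> \<open>No vertex exceeds \<open>m\<close>.\<close>
  have "candidates_from (p, Suc r, 0) = candidates_from (p, r, Suc m)"
    by (rule candidates_from_eqI) auto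
  with g have "greedy_state m K n (candidates_from (p, r, Suc m)) s" by simp
  then have "greedy_state m K n (candidates_from (p, r, 1)) (loop_vertices m K p r s)"
    unfolding loop_vertices_def
    by (intro fold_rev_upt_induct[where P = "\<lambda>u. greedy_state m K n (candidates_from (p, r, u))"])
      (auto intro: greedy_state_loop_cells r simp del: greedy_state.simps)
  \<comment> \<open>Vertices are numbered from 1, while 0 is the least possible bound.\<close>
  moreover have "candidates_from (p, r, 0) = candidates_from (p, r, 1)"
    by (rule candidates_from_eqI) auto
  ultimately show ?thesis by simp
qed

lemma greedy_state_loop_coordinates:
  assumes g: "greedy_state m K n (candidates_from (Suc p, 0, 0)) s"
  shows "greedy_state m K n (candidates_from (p, 0, 0)) (loop_coordinates m K n p s)"
proof -
  obtain W A where s: "s = (W, A)" by (cases s)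
  have C: "candidates_from (Suc p, 0, 0) = candidates_from (p, n, 0)"
    by (rule candidates_from_eqI) auto
  show ?thesis
  proof (cases "A p \<noteq> {} \<and> A (Suc p) \<noteq> {}")
    case True
    then show ?thesis
      using g unfolding C loop_coordinates_def s
      by (auto intro!: fold_rev_upt_induct[where
            P = "\<lambda>r. greedy_state m K n (candidates_from (p, r, 0))"]
          greedy_state_loop_vertices simp del: greedy_state.simps)
  next
    case False
    have "greedy_state m K n (candidates_from (Suc p, 0, 0) \<union>
        {c \<in> candidates m K n. fst (candidate_key c) = p}) (W, A)"
      by (rule greedy_state_skip[OF g[unfolded s]])
        (use False in \<open>auto simp: candidates_from_def\<close>)
    moreover have "candidates_from (Suc p, 0, 0) \<union>
        {c \<in> candidates m K n. fst (candidate_key c) = p} = candidates_from (p, 0, 0)"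
      by (auto simp: candidates_from_def)
    ultimately show ?thesis
      using False by (auto simp: loop_coordinates_def s simp del: greedy_state.simps)
  qed
qed

lemma greedy_state_W_field: "\<exists>A. greedy_state m K n (candidates m K n) (W_field m K n, A)"
proof -
  let ?s = "({}, \<lambda>p. {\<alpha> \<in> DConf K n. cell_dim \<alpha> = p}) :: state"
  \<comment> \<open>Nothing has been tried yet, so the invariant holds initially with no
    edges.\<close>
  have "candidates_from (DConf_dim K n, 0, 0) = {}"
    unfolding candidates_from_def by (auto simp: less_eq_prod_def elim!: candidates_key)
  then have "greedy_state m K n (candidates_from (DConf_dim K n, 0, 0)) ?s"
    by simp
  then have "greedy_state m K n (candidates_from (0, 0, 0))
      (fold (loop_coordinates m K n) (rev [0..<DConf_dim K n]) ?s)"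
    by (intro fold_rev_upt_induct[where P = "\<lambda>p. greedy_state m K n (candidates_from (p, 0, 0))"])
      (auto intro: greedy_state_loop_coordinates simp del: greedy_state.simps)
  moreover have "candidates_from (0, 0, 0) = candidates m K n"
    by (auto simp: candidates_from_def less_eq_prod_def)
  ultimately show ?thesis
    unfolding W_field_def
    by (intro exI[of _ "snd (fold (loop_coordinates m K n) (rev [0..<DConf_dim K n]) ?s)"])
      (simp del: greedy_state.simps)
qed

section \<open>Properties of the final field\<close>

lemma W_field_edge:
  assumes "e \<in> W_field m K n"
  obtains r u \<alpha> where "(r, u, \<alpha>) \<in> candidates m K n" "e = (add_vertex \<alpha> r u, \<alpha>)"
proof -
  obtain A where "greedy_state m K n (candidates m K n) (W_field m K n, A)"
    using greedy_state_W_field ..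
  from greedy_stateD(2)[OF this] assms obtain c where c: "c \<in> candidates m K n" "e = candidate_edge c"
    by blast
  then show thesis
    by (cases c) (auto intro: that)
qed

lemma W_field_matching:
  assumes "e \<in> W_field m K n" "e' \<in> W_field m K n" "touching e e'"
  shows "e = e'"
  using greedy_state_W_field greedy_stateD(3)[OF _ assms] by blast

text \<open>Greediness of the result: \<open>c'\<close> is \<open>c\<close> itself if its edge was
  chosen, and otherwise a candidate that blocked it.\<close>

lemma W_field_greedy:
  assumes "c \<in> candidates m K n"
  obtains c' where "c' \<in> candidates m K n" "candidate_edge c' \<in> W_field m K n"
    "touching (candidate_edge c) (candidate_edge c')" "candidate_key c \<le> candidate_key c'"
  using greedy_state_W_field greedy_stateD(5)[OF _ assms] by blast

lemma W_field_discrete: "discrete_field (DConf_hasse K n) (W_field m K n)"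
  unfolding discrete_field_def
proof (intro conjI ballI)
  show "W_field m K n \<subseteq> DConf_hasse K n"
    using candidateD(1) by (auto elim!: W_field_edge)
  fix v assume "v \<in> Field (W_field m K n)"
  then obtain e where e: "e \<in> W_field m K n" "v = fst e \<or> v = snd e"
    unfolding Field_iff_fst_snd by blast
  have "{e \<in> W_field m K n. fst e = v \<or> snd e = v} = {e}"
    using e W_field_matching[of e] by (auto simp: touching_def)
  then show "degree_in (W_field m K n) v = 1"
    by (simp add: degree_in_def)
qed


section \<open>Acyclicity\<close>

text \<open>Dimension makes the Hasse diagram asymmetric, so an upward step can only be a reversed
  field edge and a downward step only an edge outside the field.\<close>

lemma gradient_path_edges:
  assumes "gradient_path (DConf_hasse K n) (W_field m K n) as bs" "i < length bs"
  shows "(bs ! i, as ! i) \<in> W_field m K n" "(bs ! i, as ! Suc i) \<in> DConf_hasse K n"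
    "(bs ! i, as ! Suc i) \<notin> W_field m K n"
proof -
  have up: "up_edge (DConf_hasse K n) (W_field m K n) (as ! i) (bs ! i)"
    and down: "down_edge (DConf_hasse K n) (W_field m K n) (bs ! i) (as ! Suc i)"
    using assms by (auto simp: gradient_path_def)
  have asym: "(\<alpha>, \<beta>) \<notin> DConf_hasse K n" if "(\<beta>, \<alpha>) \<in> DConf_hasse K n" for \<alpha> \<beta>
    using DConf_hasse_cell_dim[OF that] DConf_hasse_cell_dim[of \<alpha> \<beta> K n] by auto
  have sub: "W_field m K n \<subseteq> DConf_hasse K n"
    using W_field_discrete by (simp add: discrete_field_def)
  show "(bs ! i, as ! i) \<in> W_field m K n" "(bs ! i, as ! Suc i) \<in> DConf_hasse K n"
    "(bs ! i, as ! Suc i) \<notin> W_field m K n"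
    using up down asym sub unfolding up_edge_def down_edge_def modified_hasse_def by blast+
qed

lemma W_field_no_cycle:
  assumes path: "gradient_path (DConf_hasse K n) (W_field m K n) as bs"
    and cycle: "hd as = last as"
  shows False
proof -
  define k where "k = length bs"
  have k: "k > 0" "length as = Suc k"
    using path by (auto simp: gradient_path_def k_def)
  then have closed: "as ! 0 = as ! k"
    using cycle by (cases as rule: list.exhaust) (auto simp: hd_conv_nth last_conv_nth)
  note edges = gradient_path_edges[OF path, folded k_def]
  have sub: "W_field m K n \<subseteq> DConf_hasse K n"
    using W_field_discrete by (simp add: discrete_field_def)
  have "\<forall>i<k. \<exists>c. c \<in> candidates m K n \<and> candidate_edge c = (bs ! i, as ! i)"
    using edges(1) by (metis W_field_edge candidate_edge.simps)
  then obtain c where c: "\<And>i. i < k \<Longrightarrow> c i \<in> candidates m K n"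
    "\<And>i. i < k \<Longrightarrow> candidate_edge (c i) = (bs ! i, as ! i)"
    by metis
  \<comment> \<open>Hence all keys on the cycle share their first component.\<close>
  have dim: "cell_dim (as ! i) = cell_dim (as ! 0)" if "i \<le> k" for i
    using that
  proof (induction i)
    case (Suc i)
    have "cell_dim (bs ! i) = Suc (cell_dim (as ! i))"
      using edges(1)[of i] sub Suc.prems by (auto intro: DConf_hasse_cell_dim)
    moreover have "cell_dim (bs ! i) = Suc (cell_dim (as ! Suc i))"
      using edges(2)[of i] Suc.prems by (auto intro: DConf_hasse_cell_dim)
    ultimately show ?case using Suc by simp
  qed simp
  define M where "M = Max ((candidate_key \<circ> c) ` {..<k})"
  have "M \<in> (candidate_key \<circ> c) ` {..<k}"
    unfolding M_def by (rule Max_in) (use k in auto)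
  then obtain i where i: "i < k" "M = candidate_key (c i)" by auto
  have max: "candidate_key (c j) \<le> M" if "j < k" for j
    unfolding M_def by (rule Max_ge) (use that in auto)
  obtain r u where ci: "c i = (r, u, as ! i)"
    using c(2)[OF i(1)] by (cases "c i") auto
  have r: "r < n" and ui: "u \<notin> as ! i ! r" and bi: "bs ! i = add_vertex (as ! i) r u"
    using candidateD[of r u "as ! i"] c[OF i(1)] by (auto simp: ci)
  have M: "M = (cell_dim (as ! 0), r, u)"
    using i dim[of i] by (simp add: ci)
  \<comment> \<open>Upward steps only add vertices, so \<open>u\<close> can leave coordinate
    \<open>r\<close> only on a downward step.\<close>
  have mono: "as ! j ! r \<subseteq> bs ! j ! r" if "j < k" for j
    using DConf_hasse_subset[of "bs ! j" "as ! j"] edges(1)[OF that] sub r by blast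
  have "length (as ! i) = n"
    using edges(1)[OF i(1)] sub by (auto simp: DConf_hasse_def DConf_iff)
  then have u_bi: "u \<in> bs ! i ! r"
    using r by (simp add: bi add_vertex_def)
  \<comment> \<open>Otherwise \<open>u\<close> would survive from \<open>bs ! i\<close> to
    \<open>as ! k = as ! 0\<close> and on to \<open>as ! i\<close>, which does not contain it in
    coordinate \<open>r\<close>.\<close>
  obtain j where j: "j < k" "u \<in> bs ! j ! r" "u \<notin> as ! Suc j ! r"
  proof (rule ccontr)
    assume "\<not> thesis"
    with that have stay: "u \<in> as ! Suc j ! r" if "j < k" "u \<in> bs ! j ! r" for j
      using that by blast
    have carry: "u \<in> as ! l ! r" if "a \<le> l" "l \<le> k" "u \<in> as ! a ! r" for a l
      using that
    proof (induction l rule: dec_induct)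
      case (step l)
      then show ?case using stay[of l] mono[of l] by auto
    qed
    have "u \<in> as ! k ! r"
      using carry[of "Suc i" k] stay[OF i(1) u_bi] i(1) by simp
    with carry[of 0 i] closed i(1) ui show False by simp
  qed
  let ?\<alpha> = "as ! Suc j"
  have \<beta>: "bs ! j = add_vertex ?\<alpha> r u" and add: "addable m K ?\<alpha> r u"
    using DConf_hasse_add_vertex[OF complex edges(2)[OF j(1)] r j(2,3)] .
  have "?\<alpha> \<in> DConf K n"
    using edges(2)[OF j(1)] by (simp add: DConf_hasse_def)
  \<comment> \<open>The downward edge is itself a candidate of key \<open>M\<close>, so some chosen
    edge of key at least \<open>M\<close> touches it.\<close>
  with add r have "(r, u, ?\<alpha>) \<in> candidates m K n"
    by (simp add: candidates_def)
  then obtain c' where c': "c' \<in> candidates m K n" "candidate_edge c' \<in> W_field m K n"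
    "touching (bs ! j, ?\<alpha>) (candidate_edge c')" "candidate_key (r, u, ?\<alpha>) \<le> candidate_key c'"
    by (rule W_field_greedy) (simp add: \<beta>)
  then have key: "M \<le> candidate_key c'"
    using dim[of "Suc j"] j(1) by (simp add: M)
  \<comment> \<open>The lower cell also starts an upward step of the cycle; if
    \<open>Suc j = k\<close>, that step is the one at index 0.\<close>
  obtain l where l: "l < k" "as ! l = ?\<alpha>"
  proof (cases "Suc j < k")
    case False
    then have "Suc j = k" using j(1) by simp
    then show thesis using that[of 0] k closed by simp
  qed (use that in blast)
  \<comment> \<open>Both ends of the downward edge already lie on field edges of the cycle, so by
    the matching property the blocker is one of these two edges, and maximality of \<open>M\<close>
    fixes its key.\<close>
  have "touching (bs ! j, as ! j) (candidate_edge c') \<or>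
      touching (bs ! l, as ! l) (candidate_edge c')"
    using c'(3) l by (auto simp: touching_def)
  then obtain q where q: "q = j \<or> q = l" "q < k" "candidate_edge c' = (bs ! q, as ! q)"
    using W_field_matching[OF edges(1) c'(2)] j(1) l(1) by metis
  then have "c q = c'"
    using c[OF q(2)] c'(1) inj_on_candidate_edge by (metis inj_onD)
  then have "candidate_key c' = M"
    using max[OF q(2)] key by simp
  then have "c' = (r, u, as ! q)"
    using q(3) by (cases c') (simp add: M)
  then have "bs ! q = add_vertex (as ! q) r u" "u \<notin> as ! q ! r"
    using q(3) candidateD(2) c'(1) by auto
  moreover have "length (as ! q) = n"
    using edges(1)[OF q(2)] sub by (auto simp: DConf_hasse_def DConf_iff)
  \<comment> \<open>For \<open>q = l\<close> the lower cells agree and adding \<open>u\<close> gives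
    the same upper cell; for \<open>q = j\<close> the upper cells agree and
    \<open>add_vertex_inject\<close> applies. Either way a downward edge would lie in the
    field.\<close>
  ultimately have "(bs ! q, as ! q) = (bs ! j, ?\<alpha>)"
    using q(1) l(2) \<beta> add_vertex_inject[of "as ! q" r u ?\<alpha>] r j(3) by auto
  with edges(1)[OF q(2)] edges(3)[OF j(1)] show False by simp
qed

end

theorem proposition3p3:
  fixes m n :: nat and K :: "nat set set"
  assumes "simplicial_complex_on m K" and "n > 0"
  shows "gradient_field (DConf_hasse K n) (W_field m K n)"
  using assms(1) W_field_discrete W_field_no_cycle unfolding gradient_field_def by blast

end
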